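(* Let $D\ge 1$ be a square-free integer, let $r>0$ be a real number, and let $t\geq 1$ be an integer. Let $X\subset C_D(r)$ be a finite nonempty set. If $$\sum_{(x,y)\in X}P(x,y)=0$$ for all $P(x,y)\in H^{\mathbb{R}}_{D,j}[x,y]$ and all integers $j$ with $0<j\le t$, then $X$ is an ellipsoidal $t$-design.
   Context: For square-free $D\ge1$ and $r>0$, define $$C_D(r)=\begin{cases}\{(x,y)\in\mathbb{R}^2: x^2+Dy^2=r\} & D\equiv 1,2 \pmod 4,\\ \{(x,y)\in\mathbb{R}^2: x^2+xy+\tfrac{1+D}{4}y^2=r\} & D\equiv 3\pmod 4.\end{cases}$$ Ellipsoidal $t$-design: a finite nonempty subset $X\subset C_D(r)$ is an ellipsoidal $t$-design if, for all polynomials $P(x,y)$ over $\mathbb{R}$ of degree $\le t$, one has, when $D\equiv 1,2\pmod 4$, $$\frac{1}{|X|}\sum_{(x,y)\in X}P(x,y)=\frac{1}{2\pi\sqrt{D}}\int_{C_D(r)}\frac{P(x,y)}{\sqrt{x^2/D^2+y^2}}\,d\sigma(x,y),$$ and, when $D\equiv 3\pmod 4$, $$\frac{1}{|X|}\sum_{(x,y)\in X}P(x,y)=\frac{\sqrt{D}}{\pi}\int_{C_D(r)}\frac{P(x,y)}{\sqrt{20x^2+(D^2+2D+5)y^2+(20+4D)xy}}\,d\sigma(x,y).$$ The right-hand sides are line integrals with respect to arc length $d\sigma$. For an integer $j\ge 1$, $H^{\mathbb{R}}_{D,j}[x,y]$ is the real vector space of polynomials spanned by $\mathrm{Re}\big((x+\omega_D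 y)^j\big)$ and $\mathrm{Im}\big((x+\omega_D y)^j\big)$ (real and imaginary parts taken treating $x,y$ as real variables), where $\omega_D=\sqrt{-D}$ if $D\equiv1,2\pmod 4$ and $\omega_D=\frac{1+\sqrt{-D}}{2}$ if $D\equiv 3\pmod 4$. *)

theory Defs
  imports "HOL-Analysis.Analysis" "HOL-Computational_Algebra.Squarefree"
begin

text \<open>A square-free \<open>D\<close> is congruent to 1, 2 or 3 modulo 4, so the \<open>else\<close> branches
  below are exactly the case \<open>D \<equiv> 1, 2\<close>.\<close>

definition ellipse :: "nat \<Rightarrow> real \<Rightarrow> (real \<times> real) set" where
  "ellipse D r =
    (if D mod 4 = 3 then {(x, y). x\<^sup>2 + x * y + (1 + real D) / 4 * y\<^sup>2 = r}
     else {(x, y). x\<^sup>2 + real D * y\<^sup>2 = r})"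

text \<open>Integral with respect to arc length over a simple closed curve, given as a point set: the
  common value of \<open>\<integral> f(\<gamma>(s)) |\<gamma>'(s)| ds\<close> over all piecewise continuously differentiable
  parametrizations \<open>\<gamma>\<close> of \<open>C\<close> that traverse it once.  The norm on pairs is the
  Euclidean one.\<close>

definition closed_parametrization :: "(real \<Rightarrow> real \<times> real) \<Rightarrow> (real \<times> real) set \<Rightarrow> bool" where
  "closed_parametrization \<gamma> C \<longleftrightarrow>
    valid_path \<gamma> \<and> simple_path \<gamma> \<and> pathfinish \<gamma> = pathstart \<gamma> \<and> path_image \<gamma> = C"

definition arc_length_integral :: "(real \<times> real) set \<Rightarrow> (real \<times> real \<Rightarrow> real) \<Rightarrow> real" where
  "arc_length_integral C f =
    (THE I. \<forall>\<gamma>. closed_parametrization \<gamma> C \<longrightarrow>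
      ((\<lambda>s. f (\<gamma> s) * norm (vector_derivative \<gamma> (at s within {0..1}))) has_integral I) {0..1})"

text \<open>Polynomials over the reals are identified with the functions they induce on the plane.\<close>

definition polys_upto :: "nat \<Rightarrow> (real \<times> real \<Rightarrow> real) set" where
  "polys_upto t = {P. \<exists>a :: nat \<Rightarrow> nat \<Rightarrow> real.
     P = (\<lambda>(x, y). \<Sum>i\<le>t. \<Sum>j\<le>t - i. a i j * x ^ i * y ^ j)}"

definition ellipsoidal_design :: "nat \<Rightarrow> real \<Rightarrow> nat \<Rightarrow> (real \<times> real) set \<Rightarrow> bool" where
  "ellipsoidal_design D r t X \<longleftrightarrow>
    finite X \<and> X \<noteq> {} \<and> X \<subseteq> ellipse D r \<and>
    (\<forall>P \<in> polys_upto t.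
      1 / real (card X) * (\<Sum>p\<in>X. P p) =
      (if D mod 4 = 3 then
         sqrt (real D) / pi * arc_length_integral (ellipse D r)
           (\<lambda>(x, y). P (x, y) /
              sqrt (20 * x\<^sup>2 + ((real D)\<^sup>2 + 2 * real D + 5) * y\<^sup>2 + (20 + 4 * real D) * x * y))
       else
         1 / (2 * pi * sqrt (real D)) * arc_length_integral (ellipse D r)
           (\<lambda>(x, y). P (x, y) / sqrt (x\<^sup>2 / (real D)\<^sup>2 + y\<^sup>2))))"

definition omega :: "nat \<Rightarrow> complex" where
  "omega D =
    (if D mod 4 = 3 then (1 + csqrt (- of_nat D)) / 2 else csqrt (- of_nat D))"

text \<open>The real span of the two polynomials \<open>Re ((x + \<omega> y)^j)\<close> and \<open>Im ((x + \<omega> y)^j)\<close>.\<close>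

definition harmonic_polys :: "nat \<Rightarrow> nat \<Rightarrow> (real \<times> real \<Rightarrow> real) set" where
  "harmonic_polys D j =
    {(\<lambda>(x, y). a * Re ((of_real x + omega D * of_real y) ^ j)
             + b * Im ((of_real x + omega D * of_real y) ^ j)) | a b :: real. True}"

end

theory Submission
  imports Defs "HOL-Complex_Analysis.Contour_Integration" "HOL-Library.Real_Mod"
begin

text \<open>The substitution \<open>z = x + \<omega> y\<close> turns the ellipse into the circle \<open>|z| = \<surd>r\<close>, and the weights
  in the definition of a design are chosen so that the weighted arc length becomes, up to a constant factor,
  the angle \<open>\<theta>\<close> on that circle.  A polynomial of degree at most \<open>t\<close> in \<open>x, y\<close> is a combination of
  monomials in \<open>z\<close> and its conjugate, hence, on the circle, of powers \<open>z\<^sup>k\<close> with \<open>k \<le> t\<close> and their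
  conjugates.  For \<open>k > 0\<close> these have sum zero over \<open>X\<close> by hypothesis and mean zero over the circle.

  That the arc length integral does not depend on the parametrization comes from lifting a simple
  closed path on the circle to a continuous angle: it is injective, hence strictly monotone, and turns
  by exactly \<open>2\<pi>\<close>.\<close>

section \<open>Integrals of periodic functions and angles of loops on a circle\<close>

lemma integral_over_period:
  fixes f :: "real \<Rightarrow> 'a::euclidean_space"
  assumes cont: "continuous_on UNIV f" and periodic: "\<And>x. f (x + p) = f x" and "p > 0"
  shows "integral {a..a + p} f = integral {0..p} f"
proof -
  interpret periodic_fun_simple f p
    by standard (rule periodic)
  have cont': "continuous_on S f" for S
    using cont continuous_on_subset by blast
  then have int: "f integrable_on {u..v}" for u v
    by (intro integrable_continuous_interval)
  \<comment> \<open>The residue of \<open>a\<close> modulo \<open>p\<close>. After shifting to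
    \<open>{c..c + p}\<close>, the interval is cut at \<open>p\<close> and the right piece is moved
    back onto \<open>{0..c}\<close>.\<close>
  define c where "c = a - of_int \<lfloor>a / p\<rfloor> * p"
  have c: "0 \<le> c" "c \<le> p"
    unfolding c_def using \<open>p > 0\<close> floor_divide_lower[of p a] floor_divide_upper[of p a]
    by (auto simp: algebra_simps)
  have a: "a = c + of_int \<lfloor>a / p\<rfloor> * p"
    by (simp add: c_def)
  have shift: "integral {u + of_int n * p..v + of_int n * p} f = integral {u..v} f" for u v n
    using integral_shift[OF cont', where a = u and b = v and c = "of_int n * p"]
    by (simp add: o_def plus_of_int)
  have "integral {a..a + p} f = integral {c..c + p} f"
    using shift[of c "\<lfloor>a / p\<rfloor>" "c + p"] a by (metis add.assoc add.commute)
  also have "\<dots> = integral {c..p} f + integral {0 + of_int 1 * p..c + of_int 1 * p} f"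
    using Henstock_Kurzweil_Integration.integral_combine[OF _ _ int, of c p "c + p"] c by simp
  also have "\<dots> = integral {0..c} f + integral {c..p} f"
    unfolding shift by simp
  also have "\<dots> = integral {0..p} f"
    using Henstock_Kurzweil_Integration.integral_combine[OF _ _ int, of 0 c p] c by simp
  finally show ?thesis .
qed

text \<open>A nonvanishing path on an interval has a continuous logarithm, whose imaginary part is
  an angle. Simplicity makes this angle injective up to the endpoint, hence strictly monotone;
  closedness makes the total turn a multiple of \<open>2 * pi\<close>, and simplicity again leaves
  only one turn. The sign \<open>\<sigma>\<close> records the orientation, so that
  \<open>\<phi>\<close> always increases.\<close>

lemma simple_loop_on_circle_angle:
  fixes z :: "real \<Rightarrow> complex"
  assumes "simple_path z" and loop: "pathfinish z = pathstart z"
    and circle: "path_image z \<subseteq> sphere 0 R" and "R > 0"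
  obtains \<phi> \<sigma> where "\<sigma> = 1 \<or> \<sigma> = -1" "continuous_on {0..1} \<phi>" "strict_mono_on {0..1} \<phi>"
    "\<phi> 1 = \<phi> 0 + 2 * pi" "\<And>s. s \<in> {0..1} \<Longrightarrow> z s = of_real R * cis (\<sigma> * \<phi> s)"
proof -
  have cont: "continuous_on {0..1} z" and free: "loop_free z"
    using assms(1) by (auto simp: simple_path_def path_def)
  have norm_z: "norm (z s) = R" if "s \<in> {0..1}" for s
    using circle that by (force simp: path_image_def)
  then have "z s \<noteq> 0" if "s \<in> {0..1}" for s
    using that \<open>R > 0\<close> by fastforce
  then obtain g where g: "continuous_on {0..1} g" "\<And>s. s \<in> {0..1} \<Longrightarrow> z s = exp (g s)"
    using continuous_logarithm_on_contractible[OF cont] convex_imp_contractible convex_real_interval(5)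
    by metis
  define \<theta> where "\<theta> = (\<lambda>s. Im (g s))"
  have z: "z s = of_real R * cis (\<theta> s)" if "s \<in> {0..1}" for s
    using g(2)[OF that] norm_z[OF that] by (simp add: \<theta>_def exp_eq_polar norm_mult)
  have cont_\<theta>: "continuous_on {0..1} \<theta>"
    unfolding \<theta>_def by (intro continuous_intros g)
  \<comment> \<open>The point 1 is left out because \<open>loop_free\<close> permits
    \<open>z 0 = z 1\<close>.\<close>
  have "inj_on \<theta> {0..<1}"
  proof (rule inj_onI)
    fix s s' assume "s \<in> {0..<1}" "s' \<in> {0..<1}" "\<theta> s = \<theta> s'"
    then have "z s = z s'" "s \<noteq> 1" "s' \<noteq> 1" "s \<in> {0..1}" "s' \<in> {0..1}"
      using z[of s] z[of s'] by auto
    then show "s = s'"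
      using free unfolding loop_free_def by blast
  qed
  moreover have "is_interval {0..<1::real}"
    by (simp add: is_interval_co)
  moreover have "continuous_on {0..<1} \<theta>"
    using cont_\<theta> by (rule continuous_on_subset) auto
  ultimately have "strict_mono_on {0..<1} \<theta> \<or> strict_antimono_on {0..<1} \<theta>"
    using injective_eq_monotone_map by blast
  then obtain \<sigma> :: real where \<sigma>: "\<sigma> = 1 \<or> \<sigma> = -1" and mono: "strict_mono_on {0..<1} (\<lambda>s. \<sigma> * \<theta> s)"
  proof
    assume "strict_mono_on {0..<1} \<theta>"
    then show ?thesis by (intro that[of 1]) auto
  next
    assume "strict_antimono_on {0..<1} \<theta>"
    then show ?thesis by (intro that[of "-1"]) (auto simp: monotone_on_def)
  qed
  define \<phi> where "\<phi> = (\<lambda>s. \<sigma> * \<theta> s)"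
  have cont_\<phi>: "continuous_on {0..1} \<phi>"
    unfolding \<phi>_def by (intro continuous_intros cont_\<theta>)
  have z_\<phi>: "z s = of_real R * cis (\<sigma> * \<phi> s)" if "s \<in> {0..1}" for s
    using z[OF that] \<sigma> by (auto simp: \<phi>_def)
  \<comment> \<open>Continuity alone gives only a weak inequality at the endpoint; the midpoint
    \<open>m\<close> supplies the strict gap.\<close>
  have less_1: "\<phi> s < \<phi> 1" if "0 \<le> s" "s < 1" for s
  proof -
    define m where "m = (s + 1) / 2"
    have m: "s < m" "m < 1" "0 \<le> m" using that by (auto simp: m_def)
    have "\<phi> s < \<phi> m"
      using mono m that by (auto simp: \<phi>_def strict_mono_on_def)
    also have "\<phi> m \<le> \<phi> 1"
    proof (rule continuous_ge_on_closure[where f = \<phi> and x = 1])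
      show "continuous_on (closure {m..<1}) \<phi>"
        using cont_\<phi> by (rule continuous_on_subset) (use m in auto)
      show "1 \<in> closure {m..<1}" using m by simp
      show "\<phi> m \<le> \<phi> x" if "x \<in> {m..<1}" for x
        using mono m that by (cases "x = m") (auto simp: \<phi>_def strict_mono_on_def less_eq_real_def)
    qed
    finally show ?thesis .
  qed
  have mono_\<phi>: "strict_mono_on {0..1} \<phi>"
  proof (rule strict_mono_onI)
    fix s s' :: real assume s: "s \<in> {0..1}" "s' \<in> {0..1}" "s < s'"
    show "\<phi> s < \<phi> s'"
    proof (cases "s' = 1")
      case False
      then show ?thesis using mono s by (auto simp: \<phi>_def strict_mono_on_def)
    qed (use less_1 s in auto)
  qed
  have "cis (\<sigma> * \<phi> 1) = cis (\<sigma> * \<phi> 0)"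
    using loop z_\<phi>[of 0] z_\<phi>[of 1] \<open>R > 0\<close> by (simp add: pathfinish_def pathstart_def)
  then have "[\<sigma> * \<phi> 0 = \<sigma> * \<phi> 1] (rmod (2 * pi))"
    unfolding cis_eq_iff by (rule rcong_sym)
  then obtain n :: int where "\<sigma> * \<phi> 1 = \<sigma> * \<phi> 0 + of_int n * (2 * pi)"
    by (auto simp: rcong_altdef)
  then obtain n :: int where n: "\<phi> 1 = \<phi> 0 + of_int n * (2 * pi)"
    using \<sigma> by (elim disjE) (auto intro: that[of n] that[of "-n"] simp: algebra_simps)
  have "n > 0"
  proof -
    have "0 < of_int n * (2 * pi)" using n less_1[of 0] by simp
    then show ?thesis by (simp add: zero_less_mult_iff)
  qed
  \<comment> \<open>With two or more turns, the angle would pass \<open>\<phi> 0 + 2 * pi\<close>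
    strictly inside the interval, and the loop would meet its starting point there.\<close>
  moreover have "n < 2"
  proof (rule ccontr)
    assume "\<not> n < 2"
    then have "2 * pi < of_int n * (2 * pi)" by simp
    then obtain s where s: "0 \<le> s" "s \<le> 1" "\<phi> s = \<phi> 0 + 2 * pi"
      using IVT'[of \<phi> 0 "\<phi> 0 + 2 * pi" 1] cont_\<phi> n by auto
    have "cis (\<sigma> * (2 * pi)) = 1"
      using \<sigma> by (auto simp: complex_eq_iff)
    then have "cis (\<sigma> * \<phi> s) = cis (\<sigma> * \<phi> 0)"
      by (simp add: s(3) distrib_left flip: cis_mult)
    then have "z s = z 0"
      using z_\<phi>[of s] z_\<phi>[of 0] s by simp
    moreover have "s \<noteq> 0" "s \<noteq> 1"
      using s n \<open>2 * pi < of_int n * (2 * pi)\<close> by auto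
    moreover have "s \<in> {0..1}" "(0::real) \<in> {0..1}"
      using s by auto
    ultimately show False
      using free unfolding loop_free_def by blast
  qed
  ultimately have "n = 1" by simp
  then have "\<phi> 1 = \<phi> 0 + 2 * pi" using n by simp
  then show ?thesis using that \<sigma> cont_\<phi> mono_\<phi> z_\<phi> by blast
qed

text \<open>Near \<open>s\<close> the angle equals \<open>\<phi> s\<close> plus the argument of
  \<open>z u / z s\<close>. This quotient is close to 1, where \<open>Ln\<close> is differentiable,
  so a merely continuous angle inherits differentiability from \<open>z\<close>.\<close>

lemma polar_angle_has_derivative:
  fixes z :: "real \<Rightarrow> complex" and \<phi> :: "real \<Rightarrow> real"
  assumes "isCont \<phi> s" and polar: "\<forall>\<^sub>F u in nhds s. z u = of_real R * cis (\<phi> u)" and "R > 0"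
    and deriv: "(z has_vector_derivative z') (at s)"
  obtains d where "(\<phi> has_real_derivative d) (at s)" "z' = of_real d * \<i> * z s"
proof -
  have zs: "z s = of_real R * cis (\<phi> s)"
    using polar eventually_nhds_x_imp_x by blast
  then have "z s \<noteq> 0" using \<open>R > 0\<close> by simp
  define w where "w = (\<lambda>u. z u / z s)"
  have "(w has_vector_derivative z' / z s) (at s)"
    unfolding w_def by (intro has_vector_derivative_divide deriv)
  moreover have "w s = 1" using \<open>z s \<noteq> 0\<close> by (simp add: w_def)
  moreover have "(Ln has_field_derivative 1) (at 1)"
    by (rule derivative_eq_intros | simp)+
  ultimately have "((Ln \<circ> w) has_vector_derivative z' / z s * 1) (at s)"
    by (intro field_vector_diff_chain_at) auto
  from bounded_linear.has_vector_derivative[OF bounded_linear_Im this]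
  have "((\<lambda>u. Im (Ln (w u))) has_real_derivative Im (z' / z s)) (at s)"
    by (simp add: o_def has_real_derivative_iff_has_vector_derivative)
  from DERIV_add[OF DERIV_const this]
  have "((\<lambda>u. \<phi> s + Im (Ln (w u))) has_real_derivative Im (z' / z s)) (at s)"
    by simp
  \<comment> \<open>Continuity of \<open>\<phi>\<close> keeps the angle difference within the range
    of the principal branch, so no multiple of \<open>2 * pi\<close> intervenes.\<close>
  moreover have "\<forall>\<^sub>F u in nhds s. \<phi> s + Im (Ln (w u)) = \<phi> u"
  proof -
    have "(\<phi> \<longlongrightarrow> \<phi> s) (nhds s)"
      using \<open>isCont \<phi> s\<close> by (simp add: isCont_def tendsto_nhds_iff)
    then have "\<forall>\<^sub>F u in nhds s. dist (\<phi> u) (\<phi> s) < pi"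
      by (rule tendstoD) simp
    with polar show ?thesis
    proof eventually_elim
      case (elim u)
      have "w u = cis (\<phi> u - \<phi> s)"
        using elim(1) zs \<open>R > 0\<close> by (simp add: w_def flip: cis_divide)
      moreover have "\<phi> u - \<phi> s \<in> {-pi<..pi}"
        using elim(2) by (auto simp: dist_real_def)
      ultimately show ?case by (simp add: Ln_cis)
    qed
  qed
  ultimately have d: "(\<phi> has_real_derivative Im (z' / z s)) (at s)"
    by (subst (asm) DERIV_cong_ev) auto
  define d where "d = Im (z' / z s)"
  \<comment> \<open>Differentiating the polar form gives a second expression for \<open>z'\<close>;
    uniqueness of the derivative identifies the two.\<close>
  have "((\<lambda>u. of_real R * cis (\<phi> u)) has_vector_derivative of_real d * \<i> * z s) (at s)"
  proof -
    have "((\<lambda>u. \<i> * of_real (\<phi> u)) has_vector_derivative \<i> * of_real d) (at s)"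
      by (intro has_vector_derivative_mult_right has_vector_derivative_of_real d[folded d_def])
    from field_vector_diff_chain_at[OF this DERIV_exp] show ?thesis
      unfolding zs cis_conv_exp o_def
      by (auto dest: has_vector_derivative_mult_right[where a = "of_real R"] simp: mult_ac)
  qed
  moreover have "((\<lambda>u. of_real R * cis (\<phi> u)) has_vector_derivative z') (at s)"
    using deriv by (subst (asm) has_vector_derivative_cong_ev) (use polar zs in auto)
  ultimately have "z' = of_real d * \<i> * z s"
    by (rule vector_derivative_unique_at[rotated])
  with d[folded d_def] show ?thesis by (rule that)
qed

section \<open>Arc length over a linear image of a circle\<close>

text \<open>A parametrization pulled back by \<open>B\<close> is a simple loop on the circle with
  some angle. Differentiating shows that its speed is the rate of the angle times
  \<open>norm (A (\<i> * z))\<close>, so substituting the angle for the parameter leaves an integral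
  over one full period, the same for all parametrizations.\<close>

lemma arc_length_integral_linear_image_circle:
  fixes A :: "complex \<Rightarrow> real \<times> real" and B :: "real \<times> real \<Rightarrow> complex"
  assumes A: "linear A" and B: "linear B"
    and AB [simp]: "\<And>p. A (B p) = p" and BA [simp]: "\<And>w. B (A w) = w"
    and "R > 0" and f: "continuous_on (A ` sphere 0 R) f"
  shows "arc_length_integral (A ` sphere 0 R) f =
    integral {0..2 * pi} (\<lambda>u. f (A (of_real R * cis u)) * norm (A (\<i> * (of_real R * cis u))))"
proof -
  note bl = A[unfolded linear_conv_bounded_linear] B[unfolded linear_conv_bounded_linear]
  have inj: "inj A" "inj B"
    by (metis BA injI) (metis AB injI)
  define H where "H = (\<lambda>u. f (A (of_real R * cis u)) * norm (A (\<i> * (of_real R * cis u))))"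
  have "continuous_on UNIV (\<lambda>u. f (A (of_real R * cis u)))"
    by (rule continuous_on_compose2[OF f], intro continuous_intros bounded_linear.continuous_on[OF bl(1)])
       (use \<open>R > 0\<close> in \<open>auto simp: norm_mult\<close>)
  then have H: "continuous_on UNIV H"
    unfolding H_def by (intro continuous_intros bounded_linear.continuous_on[OF bl(1)])
  have H_periodic: "H (u + 2 * pi) = H u" for u
    by (simp add: H_def cis_mult[symmetric])
  have param: "((\<lambda>s. f (\<gamma> s) * norm (vector_derivative \<gamma> (at s within {0..1})))
      has_integral integral {0..2 * pi} H) {0..1}"
    if "closed_parametrization \<gamma> (A ` sphere 0 R)" for \<gamma>
  proof -
    have \<gamma>: "valid_path \<gamma>" "simple_path \<gamma>" "pathfinish \<gamma> = pathstart \<gamma>" "path_image \<gamma> = A ` sphere 0 R"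
      using that by (auto simp: closed_parametrization_def)
    define z where "z = B \<circ> \<gamma>"
    have \<gamma>_z: "\<gamma> s = A (z s)" for s by (simp add: z_def)
    have "simple_path z"
      unfolding z_def using simple_path_linear_image_eq[OF B inj(2)] \<gamma>(2) by blast
    moreover have "pathfinish z = pathstart z"
      using \<gamma>(3) by (simp add: z_def pathfinish_compose pathstart_compose)
    moreover have "path_image z \<subseteq> sphere 0 R"
      unfolding z_def path_image_compose \<gamma>(4) by (auto simp: image_image)
    ultimately obtain \<phi> \<sigma> where \<sigma>: "\<sigma> = 1 \<or> \<sigma> = (-1::real)" and \<phi>: "continuous_on {0..1} \<phi>"
        "strict_mono_on {0..1} \<phi>" "\<phi> 1 = \<phi> 0 + 2 * pi"
        and z: "\<And>s. s \<in> {0..1} \<Longrightarrow> z s = of_real R * cis (\<sigma> * \<phi> s)"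
      using simple_loop_on_circle_angle \<open>R > 0\<close> by metis
    obtain S where S: "finite S" "\<gamma> C1_differentiable_on ({0..1} - S)"
      using \<gamma>(1) by (auto simp: valid_path_def piecewise_C1_differentiable_on_def)
    \<comment> \<open>At the finitely many points of \<open>S \<union> {0, 1}\<close> this value may
      be meaningless; the integral does not see them.\<close>
    define \<phi>' where "\<phi>' = deriv \<phi>"
    have deriv: "(\<phi> has_real_derivative \<phi>' s) (at s) \<and>
        norm (vector_derivative \<gamma> (at s within {0..1})) = \<phi>' s * norm (A (\<i> * z s))"
      if s: "s \<in> {0..1} - (S \<union> {0, 1})" for s
    proof -
      have nhd: "\<forall>\<^sub>F u in nhds s. u \<in> {0<..<1}"
        using s by (intro eventually_nhds_in_open) auto
      have "isCont \<phi> s"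
        using \<phi>(1) s by (auto intro: continuous_on_interior)
      then have "isCont (\<lambda>u. \<sigma> * \<phi> u) s"
        by (intro continuous_intros)
      moreover have "\<forall>\<^sub>F u in nhds s. z u = of_real R * cis (\<sigma> * \<phi> u)"
        using nhd by eventually_elim (use z in auto)
      moreover obtain D where D: "(\<gamma> has_vector_derivative D) (at s)"
        using S(2) s unfolding C1_differentiable_on_def by blast
      then have "(z has_vector_derivative B D) (at s)"
        unfolding z_def o_def by (rule bounded_linear.has_vector_derivative[OF bl(2)])
      ultimately obtain d where d: "((\<lambda>u. \<sigma> * \<phi> u) has_real_derivative d) (at s)"
          and D_eq: "B D = of_real d * \<i> * z s"
        using polar_angle_has_derivative[OF _ _ \<open>R > 0\<close>] by blast
      \<comment> \<open>The square of \<open>\<sigma>\<close> is 1, so a derivative of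
        \<open>\<sigma> * \<phi>\<close> yields one of \<open>\<phi>\<close>.\<close>
      have "\<phi> = (\<lambda>u. \<sigma> * (\<sigma> * \<phi> u))" using \<sigma> by auto
      then have d': "(\<phi> has_real_derivative \<sigma> * d) (at s)"
        using DERIV_cmult[OF d, of \<sigma>] by simp
      have "mono_on {0..1} \<phi>"
        using \<phi>(2) by (rule strict_mono_on_imp_mono_on)
      then have "0 \<le> \<sigma> * d"
        by (rule mono_on_imp_deriv_nonneg[OF _ d']) (use s in auto)
      then have "\<bar>d\<bar> = \<sigma> * d" using \<sigma> by auto
      have "D = A (d *\<^sub>R (\<i> * z s))"
        using D_eq AB[of D] by (simp add: scaleR_conv_of_real mult.assoc)
      then have "D = d *\<^sub>R A (\<i> * z s)"
        by (simp only: linear_scale[OF A])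
      moreover have "vector_derivative \<gamma> (at s within {0..1}) = D"
        using D s by (intro vector_derivative_at_within_ivl) auto
      ultimately show ?thesis
        using d' \<open>\<bar>d\<bar> = \<sigma> * d\<close> by (simp add: \<phi>'_def DERIV_imp_deriv)
    qed
    \<comment> \<open>Absorbing the orientation into the integrand allows substitution by the
      increasing angle \<open>\<phi>\<close>.\<close>
    define H' where "H' = (\<lambda>u. H (\<sigma> * u))"
    have H': "continuous_on UNIV H'"
      unfolding H'_def by (rule continuous_on_compose2[OF H]) (auto intro!: continuous_intros)
    have H'_periodic: "H' (u + 2 * pi) = H' u" for u
      using \<sigma> H_periodic[of u] H_periodic[of "-u - 2 * pi"] by (auto simp: H'_def)
    have "((\<lambda>s. \<phi>' s *\<^sub>R H' (\<phi> s)) has_integral integral {\<phi> 0..\<phi> 1} H') {0..1}"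
    proof (rule has_integral_substitution_strong)
      show "finite (S \<union> {0, 1})" using S by simp
      show "continuous_on {\<phi> 0..\<phi> 1} H'" using H' continuous_on_subset by blast
      show "\<phi> ` {0..1} \<subseteq> {\<phi> 0..\<phi> 1}"
        using strict_mono_on_imp_mono_on[OF \<phi>(2)] by (auto simp: mono_on_def)
      show "(\<phi> has_real_derivative \<phi>' s) (at s within {0..1})" if "s \<in> {0..1} - (S \<union> {0, 1})" for s
        using deriv[OF that] has_field_derivative_at_within by blast
    qed (use \<phi> in auto)
    moreover have "integral {\<phi> 0..\<phi> 1} H' = integral {0..2 * pi} H"
    proof -
      have "integral {\<phi> 0..\<phi> 1} H' = integral {0..2 * pi} H'"
        unfolding \<phi>(3) by (rule integral_over_period[OF H' H'_periodic]) simp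
      also have "\<dots> = integral {0..2 * pi} H"
      \<comment> \<open>For a reversed loop, reflection gives the integral of \<open>H\<close> over
        \<open>{-(2 * pi)..0}\<close>, which is again a full period.\<close>
      proof (cases "\<sigma> = 1")
        case False
        then have "H = (\<lambda>u. H' (- u))"
          using \<sigma> by (simp add: H'_def)
        then have "integral {0..2 * pi} H' = integral {-(2 * pi)..-0} H"
          using Henstock_Kurzweil_Integration.integral_reflect_real[of "2 * pi" 0 H'] by metis
        then show ?thesis
          using integral_over_period[OF H H_periodic, of "-(2 * pi)"] by simp
      qed (simp add: H'_def)
      finally show ?thesis .
    qed
    ultimately have "((\<lambda>s. \<phi>' s *\<^sub>R H' (\<phi> s)) has_integral integral {0..2 * pi} H) {0..1}"
      by simp
    then show ?thesis
    proof (rule has_integral_spike_finite[rotated -1])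
      show "finite (S \<union> {0, 1})" using S by simp
      show "f (\<gamma> s) * norm (vector_derivative \<gamma> (at s within {0..1})) = \<phi>' s *\<^sub>R H' (\<phi> s)"
        if "s \<in> {0..1} - (S \<union> {0, 1})" for s
        using deriv[OF that] z[of s] that by (simp add: \<gamma>_z H'_def H_def)
    qed
  qed
  \<comment> \<open>The definite description needs one actual parametrization: if there were none,
    every number would satisfy its condition vacuously.\<close>
  define \<gamma> where "\<gamma> = A \<circ> circlepath 0 R"
  have "closed_parametrization \<gamma> (A ` sphere 0 R)"
    unfolding closed_parametrization_def
  proof (intro conjI)
    have "\<gamma> C1_differentiable_on {0..1}"
      unfolding C1_differentiable_on_def \<gamma>_def o_def
    proof (intro exI conjI ballI)
      show "((\<lambda>x. A (circlepath 0 R x)) has_vector_derivative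
          A (2 * pi * \<i> * R * exp (2 * of_real pi * \<i> * x))) (at x)" for x
        by (intro bounded_linear.has_vector_derivative[OF bl(1)] has_vector_derivative_circlepath)
    qed (intro continuous_intros bounded_linear.continuous_on[OF bl(1)])
    then show "valid_path \<gamma>"
      by (simp add: valid_path_def C1_differentiable_imp_piecewise)
    show "simple_path \<gamma>"
      unfolding \<gamma>_def simple_path_linear_image_eq[OF A inj(1)] using \<open>R > 0\<close>
      by (simp add: simple_path_circlepath)
  qed (use \<open>R > 0\<close> in \<open>simp_all add: \<gamma>_def pathfinish_compose pathstart_compose path_image_compose\<close>)
  then show ?thesis
    unfolding arc_length_integral_def H_def[symmetric]
    by (intro the_equality) (use param has_integral_unique in blast)+
qed

section \<open>The coordinate \<open>z = x + \<omega> y\<close>\<close>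

definition to_complex :: "complex \<Rightarrow> real \<times> real \<Rightarrow> complex" where
  "to_complex \<omega> p = of_real (fst p) + \<omega> * of_real (snd p)"

text \<open>Solves \<open>w = x + \<omega> y\<close> for real \<open>x\<close> and \<open>y\<close>,
  and thus inverts \<open>to_complex \<omega>\<close> when \<open>Im \<omega>\<close> is
  nonzero.\<close>

definition of_complex :: "complex \<Rightarrow> complex \<Rightarrow> real \<times> real" where
  "of_complex \<omega> w = (Re w - Re \<omega> / Im \<omega> * Im w, Im w / Im \<omega>)"

lemma linear_to_complex: "linear (to_complex \<omega>)"
  by (rule linearI) (simp_all add: to_complex_def algebra_simps scaleR_conv_of_real)

lemma linear_of_complex: "linear (of_complex \<omega>)"
  by (rule linearI) (simp_all add: of_complex_def algebra_simps add_divide_distrib)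

lemma of_complex_to_complex: "Im \<omega> \<noteq> 0 \<Longrightarrow> of_complex \<omega> (to_complex \<omega> p) = p"
  by (simp add: of_complex_def to_complex_def prod_eq_iff)

lemma to_complex_of_complex: "Im \<omega> \<noteq> 0 \<Longrightarrow> to_complex \<omega> (of_complex \<omega> w) = w"
  by (simp add: of_complex_def to_complex_def complex_eq_iff)

lemma of_complex_image_sphere:
  assumes "Im \<omega> \<noteq> 0"
  shows "of_complex \<omega> ` sphere 0 R = {p. cmod (to_complex \<omega> p) = R}"
proof (intro equalityI subsetI)
  fix p assume "p \<in> {p. cmod (to_complex \<omega> p) = R}"
  then show "p \<in> of_complex \<omega> ` sphere 0 R"
    using of_complex_to_complex[OF assms, of p] by (intro rev_image_eqI[of "to_complex \<omega> p"]) auto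
qed (auto simp: to_complex_of_complex assms)

text \<open>The denominator is \<open>c\<close> times the speed of the ellipse traversed by the
  angle of \<open>z\<close>, so it cancels the arc length factor and leaves the uniform measure in
  the angle.\<close>

lemma arc_length_integral_weighted:
  assumes "Im \<omega> \<noteq> 0" and "R > 0" and "c > 0" and P: "continuous_on UNIV P"
  shows "arc_length_integral {p. cmod (to_complex \<omega> p) = R}
      (\<lambda>p. P p / (c * norm (of_complex \<omega> (\<i> * to_complex \<omega> p)))) =
    1 / c * integral {0..2 * pi} (\<lambda>u. P (of_complex \<omega> (of_real R * cis u)))"
proof -
  \<comment> \<open>The weight never vanishes on the curve, which gives both continuity of the
    integrand and the cancellation.\<close>
  have nz: "of_complex \<omega> (\<i> * w) \<noteq> 0" if "cmod w = R" for w
  proof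
    assume "of_complex \<omega> (\<i> * w) = 0"
    then have "to_complex \<omega> (of_complex \<omega> (\<i> * w)) = 0"
      by (simp add: to_complex_def)
    then show False using that \<open>R > 0\<close> by (simp add: to_complex_of_complex assms)
  qed
  let ?f = "\<lambda>p. P p / (c * norm (of_complex \<omega> (\<i> * to_complex \<omega> p)))"
  have "continuous_on (of_complex \<omega> ` sphere 0 R) ?f"
    using nz \<open>c > 0\<close>
    by (intro continuous_intros continuous_on_subset[OF P] linear_continuous_on_compose[OF _ linear_of_complex]
          linear_continuous_on_compose[OF _ linear_to_complex])
       (auto simp: of_complex_image_sphere assms(1))
  then have "arc_length_integral (of_complex \<omega> ` sphere 0 R) ?f =
      integral {0..2 * pi} (\<lambda>u. ?f (of_complex \<omega> (of_real R * cis u)) *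
        norm (of_complex \<omega> (\<i> * (of_real R * cis u))))"
    by (intro arc_length_integral_linear_image_circle[OF linear_of_complex linear_to_complex[of \<omega>]])
       (use assms in \<open>simp_all add: of_complex_to_complex to_complex_of_complex\<close>)
  also have "\<dots> = integral {0..2 * pi} (\<lambda>u. 1 / c * P (of_complex \<omega> (of_real R * cis u)))"
    using nz \<open>c > 0\<close> \<open>R > 0\<close>
    by (intro integral_cong) (simp add: to_complex_of_complex assms(1) norm_mult)
  finally show ?thesis
    by (simp add: of_complex_image_sphere assms(1))
qed

section \<open>Averages of polynomials over the circle and over \<open>X\<close>\<close>

lemma has_integral_circle_power:
  "((\<lambda>u. (of_real R * cis u) ^ k) has_integral (if k = 0 then 2 * of_real pi else 0)) {0..2 * pi}"
proof (cases "k = 0")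
  case True
  then show ?thesis
    using has_integral_const_real[of "1::complex" 0 "2 * pi"] by (simp add: scaleR_conv_of_real)
next
  case False
  \<comment> \<open>An antiderivative of the power; for \<open>k > 0\<close> it has period
    \<open>2 * pi\<close>, so its values at the two ends cancel.\<close>
  define F where "F = (\<lambda>u. (of_real R) ^ k * (exp (\<i> * of_nat k * of_real u) / (\<i> * of_nat k)))"
  have "((\<lambda>u. (of_real R * cis u) ^ k) has_integral F (2 * pi) - F 0) {0..2 * pi}"
  proof (rule fundamental_theorem_of_calculus)
    fix u :: real
    have "((\<lambda>w. (of_real R) ^ k * (exp (\<i> * of_nat k * w) / (\<i> * of_nat k)))
        has_field_derivative (of_real R) ^ k * exp (\<i> * of_nat k * of_real u)) (at (of_real u))"
      using False by (auto intro!: derivative_eq_intros)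
    moreover have "cis u ^ k = exp (\<i> * of_nat k * of_real u)"
      using exp_of_nat_mult[of k "\<i> * of_real u"] by (simp add: cis_conv_exp mult_ac)
    ultimately have "((\<lambda>w. (of_real R) ^ k * (exp (\<i> * of_nat k * w) / (\<i> * of_nat k)))
        has_field_derivative (of_real R * cis u) ^ k) (at (of_real u))"
      by (simp add: power_mult_distrib)
    then show "(F has_vector_derivative (of_real R * cis u) ^ k) (at u within {0..2 * pi})"
      unfolding F_def by (rule has_vector_derivative_at_within[OF has_vector_derivative_real_field])
  qed simp
  moreover have "exp (\<i> * of_nat k * of_real (2 * pi)) = 1"
    using exp_integer_2pi[of "of_nat k"] by (simp add: mult_ac)
  then have "F (2 * pi) = F 0"
    by (simp add: F_def)
  ultimately show ?thesis using False by simp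
qed

text \<open>The functions whose circle integral is \<open>2 * pi\<close> times their mean over
  \<open>X\<close> are closed under complex linear combinations and conjugation, and contain the
  powers of \<open>z\<close> up to \<open>t\<close>. On the circle these generate all polynomials of
  degree at most \<open>t\<close>.\<close>

lemma polynomial_average_on_circle:
  fixes P :: "real \<times> real \<Rightarrow> real"
  assumes \<omega>: "Im \<omega> \<noteq> 0" and "R > 0" and X: "finite X" "X \<noteq> {}" "\<And>p. p \<in> X \<Longrightarrow> cmod (to_complex \<omega> p) = R"
    and vanish: "\<And>k. 0 < k \<Longrightarrow> k \<le> t \<Longrightarrow> (\<Sum>p\<in>X. to_complex \<omega> p ^ k) = 0"
    and P: "P \<in> polys_upto t"
  shows "((\<lambda>u. P (of_complex \<omega> (of_real R * cis u))) has_integral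
    2 * pi / real (card X) * (\<Sum>p\<in>X. P p)) {0..2 * pi}"
proof -
  define \<kappa> where "\<kappa> = complex_of_real (2 * pi / real (card X))"
  \<comment> \<open>Complex-valued functions are allowed so that \<open>z\<close> and its conjugate
    can replace \<open>x\<close> and \<open>y\<close>.\<close>
  define Q where "Q = (\<lambda>h :: real \<times> real \<Rightarrow> complex.
    ((\<lambda>u. h (of_complex \<omega> (of_real R * cis u))) has_integral
      \<kappa> * (\<Sum>p\<in>X. h p)) {0..2 * pi})"
  let ?B = "to_complex \<omega>"
  have Q_add: "Q (\<lambda>p. g p + h p)" if "Q g" "Q h" for g h
    using has_integral_add[OF that[unfolded Q_def]] by (simp add: Q_def sum.distrib distrib_left)
  have Q_cmult: "Q (\<lambda>p. c * h p)" if "Q h" for c h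
    using has_integral_mult_right[OF that[unfolded Q_def], of c]
    by (simp add: Q_def sum_distrib_left mult_ac)
  have "cnj \<kappa> = \<kappa>" by (simp add: \<kappa>_def)
  then have Q_cnj: "Q (\<lambda>p. cnj (h p))" if "Q h" for h
    using that unfolding Q_def by (subst (asm) has_integral_cnj[symmetric]) (simp add: o_def)
  \<comment> \<open>Only values on the curve enter \<open>Q\<close>, so the relation
    \<open>z * cnj z = R ^ 2\<close> may be used freely.\<close>
  have Q_cong: "Q g" if "Q h" "\<And>p. cmod (?B p) = R \<Longrightarrow> g p = h p" for g h
  proof -
    have "g (of_complex \<omega> (of_real R * cis u)) = h (of_complex \<omega> (of_real R * cis u))" for u
      using \<open>R > 0\<close> by (intro that(2)) (simp add: to_complex_of_complex \<omega> norm_mult)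
    moreover have "(\<Sum>p\<in>X. g p) = (\<Sum>p\<in>X. h p)"
      by (intro sum.cong refl that(2) X(3))
    ultimately show ?thesis using that(1) by (simp add: Q_def)
  qed
  have Q_power: "Q (\<lambda>p. ?B p ^ k)" if "k \<le> t" for k
    using has_integral_circle_power[of R k] vanish[of k] that X(1,2)
    by (cases "k = 0") (simp_all add: Q_def \<kappa>_def to_complex_of_complex \<omega>)
  \<comment> \<open>Pairing factors of \<open>z\<close> with factors of its conjugate turns each
    pair into the constant \<open>R ^ 2\<close> and leaves a pure power of one of them.\<close>
  have Q_mixed: "Q (\<lambda>p. ?B p ^ a * cnj (?B p) ^ b)" if "a + b \<le> t" for a b
  proof (cases "b \<le> a")
    case True
    show ?thesis
    proof (rule Q_cong)
      show "Q (\<lambda>p. of_real (R ^ (2 * b)) * ?B p ^ (a - b))"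
        using that by (intro Q_cmult Q_power) simp
      fix p assume "cmod (?B p) = R"
      then have "?B p * cnj (?B p) = of_real (R ^ 2)"
        by (simp flip: complex_norm_square)
      then have "(?B p * cnj (?B p)) ^ b = of_real (R ^ (2 * b))"
        by (simp add: power_mult)
      moreover have "?B p ^ a = ?B p ^ b * ?B p ^ (a - b)"
        using True by (simp flip: power_add)
      ultimately show "?B p ^ a * cnj (?B p) ^ b = of_real (R ^ (2 * b)) * ?B p ^ (a - b)"
        by (simp add: power_mult_distrib mult_ac)
    qed
  next
    case False
    show ?thesis
    proof (rule Q_cong)
      show "Q (\<lambda>p. of_real (R ^ (2 * a)) * cnj (?B p ^ (b - a)))"
        using that by (intro Q_cmult Q_cnj Q_power) simp
      fix p assume "cmod (?B p) = R"
      then have "?B p * cnj (?B p) = of_real (R ^ 2)"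
        by (simp flip: complex_norm_square)
      then have "(?B p * cnj (?B p)) ^ a = of_real (R ^ (2 * a))"
        by (simp add: power_mult)
      moreover have "cnj (?B p) ^ b = cnj (?B p) ^ a * cnj (?B p) ^ (b - a)"
        using False by (simp flip: power_add)
      ultimately show "?B p ^ a * cnj (?B p) ^ b = of_real (R ^ (2 * a)) * cnj (?B p ^ (b - a))"
        by (simp add: power_mult_distrib mult_ac)
    qed
  qed
  \<comment> \<open>Up to sign, the determinant of the linear system expressing \<open>z\<close> and
    its conjugate in \<open>x\<close> and \<open>y\<close>.\<close>
  define v where "v = 2 * \<i> * of_real (Im \<omega>)"
  have "v \<noteq> 0" using \<omega> by (simp add: v_def)
  have v_omega: "\<omega> - cnj \<omega> = v" by (simp add: v_def complex_eq_iff)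
  have x_eq: "of_real (fst p) = \<omega> / v * cnj (?B p) - cnj \<omega> / v * ?B p" for p
  proof -
    have "v * of_real (fst p) = \<omega> * cnj (?B p) - cnj \<omega> * ?B p"
      by (simp add: to_complex_def algebra_simps flip: v_omega)
    then show ?thesis using \<open>v \<noteq> 0\<close> by (simp add: field_simps)
  qed
  have y_eq: "of_real (snd p) = 1 / v * ?B p - 1 / v * cnj (?B p)" for p
  proof -
    have "v * of_real (snd p) = ?B p - cnj (?B p)"
      by (simp add: to_complex_def algebra_simps flip: v_omega)
    then show ?thesis using \<open>v \<noteq> 0\<close> by (simp add: field_simps)
  qed
  \<comment> \<open>Each induction step trades one factor \<open>x\<close> for a combination of
    \<open>z\<close> and its conjugate. The total degree stays fixed while \<open>a\<close> or
    \<open>b\<close> grows, hence the general exponents.\<close>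
  have Q_x: "Q (\<lambda>p. ?B p ^ a * cnj (?B p) ^ b * of_real (fst p) ^ i)" if "a + b + i \<le> t" for a b i
    using that
  proof (induction i arbitrary: a b)
    case 0
    then show ?case using Q_mixed by simp
  next
    case (Suc i)
    have "Q (\<lambda>p. \<omega> / v * (?B p ^ a * cnj (?B p) ^ Suc b * of_real (fst p) ^ i) +
        - (cnj \<omega> / v) * (?B p ^ Suc a * cnj (?B p) ^ b * of_real (fst p) ^ i))"
      using Suc.prems by (intro Q_add Q_cmult Suc.IH) simp_all
    then show ?case
      by (rule Q_cong) (simp add: x_eq algebra_simps)
  qed
  have Q_xy: "Q (\<lambda>p. ?B p ^ a * cnj (?B p) ^ b * of_real (fst p) ^ i * of_real (snd p) ^ j)"
    if "a + b + i + j \<le> t" for a b i j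
    using that
  proof (induction j arbitrary: a b)
    case 0
    then show ?case using Q_x by simp
  next
    case (Suc j)
    have "Q (\<lambda>p. 1 / v * (?B p ^ Suc a * cnj (?B p) ^ b * of_real (fst p) ^ i * of_real (snd p) ^ j) +
        - (1 / v) * (?B p ^ a * cnj (?B p) ^ Suc b * of_real (fst p) ^ i * of_real (snd p) ^ j))"
      using Suc.prems by (intro Q_add Q_cmult Suc.IH) simp_all
    then show ?case
      by (rule Q_cong) (simp add: y_eq algebra_simps)
  qed
  obtain c :: "nat \<Rightarrow> nat \<Rightarrow> real"
    where P_eq: "P = (\<lambda>(x, y). \<Sum>i\<le>t. \<Sum>j\<le>t - i. c i j * x ^ i * y ^ j)"
    using P by (auto simp: polys_upto_def)
  have Q_0: "Q (\<lambda>p. 0)" by (simp add: Q_def)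
  have Q_sum: "Q (\<lambda>p. \<Sum>i\<in>I. h i p)" if "finite I" "\<And>i. i \<in> I \<Longrightarrow> Q (h i)" for I :: "nat set" and h
    using that by (induction rule: finite_induct) (auto intro: Q_add Q_0)
  have "Q (\<lambda>p. \<Sum>i\<le>t. \<Sum>j\<le>t - i. of_real (c i j) * (?B p ^ 0 * cnj (?B p) ^ 0 *
      of_real (fst p) ^ i * of_real (snd p) ^ j))"
    by (intro Q_sum Q_cmult Q_xy) auto
  then have "Q (\<lambda>p. of_real (P p))"
    by (rule Q_cong) (simp add: P_eq case_prod_unfold mult_ac)
  then have "((\<lambda>u. complex_of_real (P (of_complex \<omega> (of_real R * cis u)))) has_integral
      of_real (2 * pi / real (card X) * (\<Sum>p\<in>X. P p))) {0..2 * pi}"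
    by (simp add: Q_def \<kappa>_def)
  from has_integral_linear[OF this bounded_linear_Re] show ?thesis
    by (simp only: o_def Re_complex_of_real)
qed

lemma polys_upto_continuous:
  assumes "P \<in> polys_upto t"
  shows "continuous_on UNIV P"
proof -
  obtain a :: "nat \<Rightarrow> nat \<Rightarrow> real"
    where P: "P = (\<lambda>(x, y). \<Sum>i\<le>t. \<Sum>j\<le>t - i. a i j * x ^ i * y ^ j)"
    using assms by (auto simp: polys_upto_def)
  show ?thesis
    unfolding P case_prod_unfold by (intro continuous_intros)
qed

section \<open>The ellipse and its weights in terms of \<open>omega D\<close>\<close>

lemma omega_eq:
  "omega D = (if D mod 4 = 3 then Complex (1 / 2) (sqrt (real D) / 2) else Complex 0 (sqrt (real D)))"
proof -
  have "csqrt (- of_nat D) = \<i> * of_real (sqrt (real D))"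
    using csqrt_of_real_nonpos[of "- real D"] by simp
  then show ?thesis by (auto simp: omega_def complex_eq_iff)
qed

text \<open>The quadratic form of the ellipse is the norm form: the squared modulus of
  \<open>x + \<omega> y\<close>.\<close>

lemma ellipse_eq:
  assumes "r \<ge> 0"
  shows "ellipse D r = {p. cmod (to_complex (omega D) p) = sqrt r}"
proof -
  have "cmod (to_complex (omega D) p) = sqrt r \<longleftrightarrow>
      Re (to_complex (omega D) p)^2 + Im (to_complex (omega D) p)^2 = r" for p
    by (simp add: cmod_def)
  then show ?thesis
    by (auto simp: ellipse_def omega_eq to_complex_def power2_eq_square field_simps)
qed

text \<open>Multiplication of \<open>z\<close> by \<open>\<i>\<close> is differentiation in the
  angle, so \<open>\<tau>\<close> is the speed of the ellipse in that parameter. Each radicand is a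
  constant times \<open>\<tau>\<^sup>2\<close>: the factor is \<open>4 * D\<close> for
  \<open>D\<close> congruent to 3, and \<open>1 / D\<close> otherwise.\<close>

lemma design_weight_eq:
  fixes x y :: real
  assumes "D \<ge> 1"
  defines "\<tau> \<equiv> norm (of_complex (omega D) (\<i> * to_complex (omega D) (x, y)))"
  shows "D mod 4 = 3 \<Longrightarrow> sqrt (20 * x\<^sup>2 + ((real D)\<^sup>2 + 2 * real D + 5) * y\<^sup>2 + (20 + 4 * real D) * x * y)
      = 2 * sqrt (real D) * \<tau>"
    and "D mod 4 \<noteq> 3 \<Longrightarrow> sqrt (x\<^sup>2 / (real D)\<^sup>2 + y\<^sup>2) = 1 / sqrt (real D) * \<tau>"
proof -
  \<comment> \<open>With \<open>D\<close> written as a square, both claims become identities of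
    rational functions in \<open>s\<close>, \<open>x\<close> and \<open>y\<close>.\<close>
  define s where "s = sqrt (real D)"
  have s: "s > 0" "real D = s\<^sup>2" using assms(1) by (simp_all add: s_def)
  have s_omega: "omega D = (if D mod 4 = 3 then Complex (1 / 2) (s / 2) else Complex 0 s)"
    by (simp add: omega_eq s_def)
  note \<tau> = \<tau>_def s_omega to_complex_def of_complex_def norm_Pair
  show "sqrt (20 * x\<^sup>2 + ((real D)\<^sup>2 + 2 * real D + 5) * y\<^sup>2 + (20 + 4 * real D) * x * y)
      = 2 * sqrt (real D) * \<tau>" if "D mod 4 = 3"
  proof (rule real_sqrt_unique)
    have "\<tau>\<^sup>2 = (- (s / 2 * y) - (x + y / 2) / s)\<^sup>2 + ((x + y / 2) / (s / 2))\<^sup>2"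
      using that s(1) by (simp add: \<tau> power_divide)
    also have "\<dots> = ((s\<^sup>2 * y / 2 + (x + y / 2))\<^sup>2 + (2 * x + y)\<^sup>2) / s\<^sup>2"
      using s(1) by (simp add: divide_simps) (simp add: power2_eq_square algebra_simps)
    finally have "4 * s\<^sup>2 * \<tau>\<^sup>2 = 4 * ((s\<^sup>2 * y / 2 + (x + y / 2))\<^sup>2 + (2 * x + y)\<^sup>2)"
      using s(1) by simp
    then show "(2 * sqrt (real D) * \<tau>)\<^sup>2 =
        20 * x\<^sup>2 + ((real D)\<^sup>2 + 2 * real D + 5) * y\<^sup>2 + (20 + 4 * real D) * x * y"
      unfolding s_def[symmetric] s(2)
      by (simp add: power_mult_distrib) (simp add: power2_eq_square power4_eq_xxxx algebra_simps)
  qed (simp add: \<tau>_def)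
  show "sqrt (x\<^sup>2 / (real D)\<^sup>2 + y\<^sup>2) = 1 / sqrt (real D) * \<tau>" if "D mod 4 \<noteq> 3"
  proof (rule real_sqrt_unique)
    have "\<tau>\<^sup>2 = (s * y)\<^sup>2 + (x / s)\<^sup>2"
      using that s(1) by (simp add: \<tau> power_divide)
    then show "(1 / sqrt (real D) * \<tau>)\<^sup>2 = x\<^sup>2 / (real D)\<^sup>2 + y\<^sup>2"
      using s(1) unfolding s_def[symmetric] s(2)
      by (simp add: power_mult_distrib power_divide add_divide_distrib add.commute)
  qed (simp add: \<tau>_def)
qed

section \<open>From vanishing harmonic sums to the design identity\<close>

theorem theorem1p1:
  fixes D t :: nat and r :: real and X :: "(real \<times> real) set"
  assumes "D \<ge> 1" and "squarefree D"
    and "r > 0"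
    and "t \<ge> 1"
    and "finite X" and "X \<noteq> {}" and "X \<subseteq> ellipse D r"
    and "\<And>j P. 0 < j \<Longrightarrow> j \<le> t \<Longrightarrow> P \<in> harmonic_polys D j \<Longrightarrow> (\<Sum>p\<in>X. P p) = 0"
  shows "ellipsoidal_design D r t X"
proof -
  have \<omega>: "Im (omega D) \<noteq> 0" using assms(1) by (simp add: omega_eq)
  have C: "ellipse D r = {p. cmod (to_complex (omega D) p) = sqrt r}"
    using assms(3) by (intro ellipse_eq) simp
  have vanish: "(\<Sum>p\<in>X. to_complex (omega D) p ^ k) = 0" if "0 < k" "k \<le> t" for k
  proof -
    have "(\<lambda>(x, y). a * Re ((of_real x + omega D * of_real y) ^ k)
        + b * Im ((of_real x + omega D * of_real y) ^ k)) \<in> harmonic_polys D k" for a b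
      unfolding harmonic_polys_def by blast
    \<comment> \<open>The two coefficient choices give the real and the imaginary part of the power
      sum.\<close>
    from assms(8)[OF that this[of 1 0]] assms(8)[OF that this[of 0 1]] show ?thesis
      by (simp add: complex_eq_iff to_complex_def case_prod_unfold)
  qed
  \<comment> \<open>The scale \<open>c\<close> stays free to cover both cases:
    \<open>2 * sqrt D\<close> and \<open>1 / sqrt D\<close> make \<open>c / (2 * pi)\<close> the
    respective normalizing factor in the definition of a design.\<close>
  have average: "1 / real (card X) * (\<Sum>p\<in>X. P p) =
      c / (2 * pi) * arc_length_integral (ellipse D r)
        (\<lambda>p. P p / (c * norm (of_complex (omega D) (\<i> * to_complex (omega D) p))))"
    if "P \<in> polys_upto t" "c > 0" for P c
  proof -
    have "integral {0..2 * pi} (\<lambda>u. P (of_complex (omega D) (of_real (sqrt r) * cis u))) =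
        2 * pi / real (card X) * (\<Sum>p\<in>X. P p)"
      using assms(3,5-7) vanish that(1) \<omega> C
      by (intro integral_unique polynomial_average_on_circle[where t = t]) auto
    then show ?thesis
      unfolding C using assms(3) \<omega> that
      by (subst arc_length_integral_weighted) (auto intro: polys_upto_continuous)
  qed
  have "1 / real (card X) * (\<Sum>p\<in>X. P p) =
      (if D mod 4 = 3 then
         sqrt (real D) / pi * arc_length_integral (ellipse D r)
           (\<lambda>(x, y). P (x, y) /
              sqrt (20 * x\<^sup>2 + ((real D)\<^sup>2 + 2 * real D + 5) * y\<^sup>2 + (20 + 4 * real D) * x * y))
       else
         1 / (2 * pi * sqrt (real D)) * arc_length_integral (ellipse D r)
           (\<lambda>(x, y). P (x, y) / sqrt (x\<^sup>2 / (real D)\<^sup>2 + y\<^sup>2)))"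
    if P: "P \<in> polys_upto t" for P
  proof (cases "D mod 4 = 3")
    case True
    have "2 * sqrt (real D) > 0" using assms(1) by simp
    note avg = average[OF P this]
    show ?thesis
      unfolding avg design_weight_eq(1)[OF assms(1) True] case_prod_unfold prod.collapse
      using True by simp
  next
    case False
    have "1 / sqrt (real D) > 0" using assms(1) by simp
    note avg = average[OF P this]
    show ?thesis
      unfolding avg design_weight_eq(2)[OF assms(1) False] case_prod_unfold prod.collapse
      using False by simp
  qed
  then show ?thesis
    using assms(5-7) by (simp add: ellipsoidal_design_def)
qed

end
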